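(* Let $N\ge 3$, $1\le r\le N$, let $R$ be a set of $r$ rim vertices of the wheel graph $W_{N+1}$, and let $d_1,\ldots,d_r$ be the cyclic intervals of $R$. Then $$\mathcal F_{W_{N+1}}(R)=\sum_{i=1}^{r}m^*(C_{2d_i})\prod_{\substack{1\le j\le r\\ j\ne i}}m(P_{2d_j-1}),$$ where $m(P_n)$ is the number of matchings of the path graph $P_n$ on $n$ vertices and $m^*(C_{2d})$ is the number of imperfect matchings of the cycle graph $C_{2d}$ (with the convention $m^*(C_2)=1$).
   Context: The wheel graph $W_{N+1}$ ($N\ge3$) has vertex set $\{c,v_1,\ldots,v_N\}$ and edges $\{v_i,v_{i+1}\}$ (indices modulo $N$) and $\{c,v_i\}$ for $1\le i\le N$; $c$ is the central vertex and the $v_i$ are the rim vertices. For a set $R=\{v_{a_1},\ldots,v_{a_r}\}$ of rim vertices with $1\le a_1<\cdots<a_r\le N$, the cyclic intervals are $d_i=a_{i+1}-a_i$ for $1\le i\le r-1$ and $d_r=a_1+N-a_r$. For a finite connected graph $G$ and $\varnothing\ne R\subseteq V(G)$, a rooted spanning forest of $G$ with root set $R$ is a spanning forest (an acyclic subgraph containing all vertices of $G$) in which each connected component contains exactly one vertex of $R$; $\mathcal F_G(R)$ denotes the number of such forests. A matching of a graph is a set of edges no two of which share an endpoint; the empty set is a matching. A matching is perfect if it covers all vertices, and imperfect otherwise. $C_2$ is regarded as a $2$-cycle with two parallel edges between two vertices, so $m^*(C_2)=1$. *)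

theory Defs
  imports Main
begin

text \<open>
  Undirected multigraphs: edges have an identity of their own and \<open>ends G e\<close> is the set of
  endpoints of \<open>e\<close>. Parallel edges are needed for the 2-cycle.
\<close>

record ('v, 'e) ugraph =
  verts :: "'v set"
  edges :: "'e set"
  ends :: "'e \<Rightarrow> 'v set"

definition path_graph :: "nat \<Rightarrow> (nat, nat) ugraph" where
  "path_graph n = \<lparr>verts = {..<n}, edges = {i. Suc i < n}, ends = (\<lambda>i. {i, Suc i})\<rparr>"

text \<open>For \<open>n = 2\<close> the edges 0 and 1 are distinct and both join the vertices 0 and 1.\<close>

definition cycle_graph :: "nat \<Rightarrow> (nat, nat) ugraph" where
  "cycle_graph n = \<lparr>verts = {..<n}, edges = {..<n}, ends = (\<lambda>i. {i, Suc i mod n})\<rparr>"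

datatype wheel_vertex = Center | Rim nat

datatype wheel_edge = Rim_Edge nat | Spoke nat

fun wheel_ends :: "nat \<Rightarrow> wheel_edge \<Rightarrow> wheel_vertex set" where
  "wheel_ends N (Rim_Edge i) = {Rim i, Rim (if i = N then 1 else i + 1)}"
| "wheel_ends N (Spoke i) = {Center, Rim i}"

text \<open>\<open>wheel_graph N\<close> has \<open>N\<close> rim vertices, hence \<open>N + 1\<close> vertices in total.\<close>

definition wheel_graph :: "nat \<Rightarrow> (wheel_vertex, wheel_edge) ugraph" where
  "wheel_graph N =
    \<lparr>verts = insert Center (Rim ` {1..N}),
     edges = Rim_Edge ` {1..N} \<union> Spoke ` {1..N},
     ends = wheel_ends N\<rparr>"

definition cyclic_interval :: "nat \<Rightarrow> nat \<Rightarrow> (nat \<Rightarrow> nat) \<Rightarrow> nat \<Rightarrow> nat" where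
  "cyclic_interval N r a i = (if i < r then a (i + 1) - a i else a 1 + N - a r)"

definition matching :: "('v, 'e) ugraph \<Rightarrow> 'e set \<Rightarrow> bool" where
  "matching G M \<longleftrightarrow> M \<subseteq> edges G \<and> (\<forall>e\<in>M. \<forall>f\<in>M. e \<noteq> f \<longrightarrow> ends G e \<inter> ends G f = {})"

definition perfect_matching :: "('v, 'e) ugraph \<Rightarrow> 'e set \<Rightarrow> bool" where
  "perfect_matching G M \<longleftrightarrow> matching G M \<and> (\<Union>e\<in>M. ends G e) = verts G"

definition num_matchings :: "('v, 'e) ugraph \<Rightarrow> nat" where
  "num_matchings G = card {M. matching G M}"

definition num_imperfect_matchings :: "('v, 'e) ugraph \<Rightarrow> nat" where
  "num_imperfect_matchings G = card {M. matching G M \<and> \<not> perfect_matching G M}"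

lemma num_imperfect_matchings_cycle_graph_2:
  "num_imperfect_matchings (cycle_graph 2) = 1"
proof -
  have "M = {}" if "matching (cycle_graph 2) M" "\<not> perfect_matching (cycle_graph 2) M" for M
  proof (rule ccontr)
    assume "M \<noteq> {}"
    then obtain e where "e \<in> M" by blast
    have sub: "M \<subseteq> {..<2}"
      using that(1) by (simp add: matching_def cycle_graph_def)
    have ends: "{i, Suc i mod 2} = {..<2}" if "i \<in> M" for i
    proof -
      have "i = 0 \<or> i = 1" using that sub by auto
      then show ?thesis by auto
    qed
    have "(\<Union>i\<in>M. {i, Suc i mod 2}) = {..<2}"
      using ends \<open>e \<in> M\<close> by blast
    then show False
      using that by (simp add: perfect_matching_def cycle_graph_def)
  qed
  moreover have "matching (cycle_graph 2) {}" "\<not> perfect_matching (cycle_graph 2) {}"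
    by (simp_all add: matching_def perfect_matching_def cycle_graph_def lessThan_nat_numeral)
  ultimately have "{M. matching (cycle_graph 2) M \<and> \<not> perfect_matching (cycle_graph 2) M} = {{}}"
    by blast
  then show ?thesis by (simp add: num_imperfect_matchings_def)
qed

text \<open>
  A cycle is given by its cyclic sequences of distinct vertices and distinct edges; one loop or two
  parallel edges count as a cycle.
\<close>

definition is_cycle :: "('v, 'e) ugraph \<Rightarrow> 'v list \<Rightarrow> 'e list \<Rightarrow> bool" where
  "is_cycle G vs es \<longleftrightarrow>
    es \<noteq> [] \<and> length vs = length es \<and> distinct vs \<and> distinct es \<and>
    set vs \<subseteq> verts G \<and> set es \<subseteq> edges G \<and>
    (\<forall>i<length es. ends G (es ! i) = {vs ! i, vs ! (Suc i mod length es)})"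

definition acyclic_graph :: "('v, 'e) ugraph \<Rightarrow> bool" where
  "acyclic_graph G \<longleftrightarrow> \<not> (\<exists>vs es. is_cycle G vs es)"

definition adjacency :: "('v, 'e) ugraph \<Rightarrow> ('v \<times> 'v) set" where
  "adjacency G = {(u, v). \<exists>e\<in>edges G. ends G e = {u, v}}"

definition components :: "('v, 'e) ugraph \<Rightarrow> 'v set set" where
  "components G = {{v \<in> verts G. (u, v) \<in> (adjacency G)\<^sup>*} | u. u \<in> verts G}"

text \<open>
  A spanning forest contains all vertices of \<open>G\<close>, so it is determined by its edge set \<open>F\<close>; as a
  graph it is \<open>G\<lparr>edges := F\<rparr>\<close>.
\<close>

definition rooted_spanning_forest :: "('v, 'e) ugraph \<Rightarrow> 'v set \<Rightarrow> 'e set \<Rightarrow> bool" where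
  "rooted_spanning_forest G R F \<longleftrightarrow>
    F \<subseteq> edges G \<and> acyclic_graph (G\<lparr>edges := F\<rparr>) \<and>
    (\<forall>C\<in>components (G\<lparr>edges := F\<rparr>). \<exists>!v. v \<in> C \<and> v \<in> R)"

definition num_rooted_spanning_forests :: "('v, 'e) ugraph \<Rightarrow> 'v set \<Rightarrow> nat" where
  "num_rooted_spanning_forests G R = card {F. rooted_spanning_forest G R F}"

end

theory Submission
  imports Defs "HOL-Number_Theory.Fib"
begin

text \<open>
  After all roots are identified to a single vertex, a rooted spanning forest becomes a spanning tree, and
  the wheel falls apart into \<open>r\<close> pieces that share only that vertex and the center \<open>c\<close>: the arc between two
  consecutive roots with its spokes. In a spanning tree exactly one piece joins the root vertex to \<open>c\<close>,
  while each other piece is a forest separating the two. A piece of length \<open>d\<close> is a wheel on \<open>d\<close> rim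
  vertices, so the first kind has \<open>L\<^sub>2\<^sub>d - 2 = m\<^sup>*(C\<^sub>2\<^sub>d)\<close> choices (\<open>L\<close> being the Lucas numbers) and the
  second \<open>fib (2 * d) = m(P\<^sub>2\<^sub>d\<^sub>-\<^sub>1)\<close>. The numbers for the pieces arise by deciding the edges one by one along
  the rim, remembering only which of the root vertex, \<open>c\<close> and the current vertex are already joined.
\<close>

section \<open>Matchings of paths and cycles\<close>

text \<open>Edge \<open>i\<close> of a path joins \<open>i\<close> and \<open>Suc i\<close>, so two
  distinct edges meet exactly when their numbers are consecutive.\<close>

definition sparse :: "nat set \<Rightarrow> bool" where
  "sparse M \<longleftrightarrow> (\<forall>i. i \<in> M \<longrightarrow> Suc i \<notin> M)"

lemma inj_on_insert: "(\<And>A. A \<in> \<A> \<Longrightarrow> x \<notin> A) \<Longrightarrow> inj_on (insert x) \<A>"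
  by (rule inj_on_inverseI[of _ "\<lambda>A. A - {x}"]) simp

text \<open>Splitting by the largest available index gives the Fibonacci recurrence, since choosing
  it rules out its predecessor. The offset \<open>k\<close> serves cycles, where index 0 may have to
  be skipped.\<close>

lemma card_sparse: "card {M. M \<subseteq> {k..<k + n} \<and> sparse M} = fib (n + 2)"
proof (induction n rule: fib.induct)
  case 1
  have "{M. M \<subseteq> {k..<k + 0} \<and> sparse M} = {{}}"
    by (auto simp: sparse_def)
  then show ?case by simp
next
  case 2
  have "{M. M \<subseteq> {k..<k + Suc 0} \<and> sparse M} = {{}, {k}}"
    by (auto simp: sparse_def)
  then show ?case by (simp add: numeral_2_eq_2)
next
  case (3 n)
  let ?S = "\<lambda>n. {M. M \<subseteq> {k..<k + n} \<and> sparse M}"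
  have fin: "finite (?S m)" for m
    by (rule finite_subset[of _ "Pow {k..<k + m}"]) auto
  let ?f = "insert (k + Suc n)"
  have "?S (Suc (Suc n)) \<subseteq> ?S (Suc n) \<union> ?f ` ?S n"
  proof
    fix M assume M: "M \<in> ?S (Suc (Suc n))"
    show "M \<in> ?S (Suc n) \<union> ?f ` ?S n"
    proof (cases "k + Suc n \<in> M")
      case True
      then have "k + n \<notin> M"
        using M by (auto simp: sparse_def)
      then have "M - {k + Suc n} \<in> ?S n"
        using M True by (fastforce simp: sparse_def less_Suc_eq)
      moreover have "M = ?f (M - {k + Suc n})"
        using True by auto
      ultimately show ?thesis
        by blast
    next
      case False
      have "M \<subseteq> {k..<k + Suc n}"
      proof
        fix x assume "x \<in> M"
        then have "x \<in> {k..<k + Suc (Suc n)}" "x \<noteq> k + Suc n"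
          using M False by blast+
        then show "x \<in> {k..<k + Suc n}"
          by auto
      qed
      then show ?thesis
        using M by simp
    qed
  qed
  moreover have "?S (Suc n) \<union> ?f ` ?S n \<subseteq> ?S (Suc (Suc n))"
    by (fastforce simp: sparse_def subset_iff less_Suc_eq)
  ultimately have "?S (Suc (Suc n)) = ?S (Suc n) \<union> ?f ` ?S n"
    by (rule subset_antisym)
  moreover have "?S (Suc n) \<inter> ?f ` ?S n = {}"
    by auto
  moreover have "inj_on ?f (?S n)"
    by (rule inj_on_insert) auto
  ultimately show ?case
    using 3 by (simp add: card_Un_disjoint card_image fin)
qed

lemma num_matchings_path_graph: "num_matchings (path_graph n) = fib (Suc n)"
proof (cases n)
  case 0
  have "{M. matching (path_graph n) M} = {{}}"
    using 0 by (auto simp: matching_def path_graph_def)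
  then show ?thesis
    using 0 by (simp add: num_matchings_def)
next
  case (Suc m)
  have "matching (path_graph n) M \<longleftrightarrow> M \<subseteq> {0..<0 + m} \<and> sparse M" for M
    using Suc by (fastforce simp: matching_def path_graph_def sparse_def)
  then show ?thesis
    using Suc card_sparse[of 0 m] by (simp add: num_matchings_def)
qed

text \<open>Distinct edges of a cycle meet exactly when one is the cyclic successor of the other.
  With \<open>n \<ge> 2\<close> no edge succeeds itself, and for \<open>n = 2\<close> the parallel
  edges succeed each other.\<close>

lemma matching_cycle_graph_iff:
  assumes "n \<ge> 2"
  shows "matching (cycle_graph n) M \<longleftrightarrow> M \<subseteq> {..<n} \<and> (\<forall>i\<in>M. Suc i mod n \<notin> M)"
proof -
  have neq: "Suc i mod n \<noteq> i" if "i < n" for i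
    using assms that by (cases "Suc i = n") auto
  have inj: "i = j" if "Suc i mod n = Suc j mod n" "i < n" "j < n" for i j
    using that by (auto simp: mod_Suc split: if_splits)
  have "(\<forall>e\<in>M. \<forall>f\<in>M. e \<noteq> f \<longrightarrow> {e, Suc e mod n} \<inter> {f, Suc f mod n} = {}) \<longleftrightarrow>
      (\<forall>i\<in>M. Suc i mod n \<notin> M)" (is "?L \<longleftrightarrow> ?R") if M: "M \<subseteq> {..<n}"
  proof
    assume L: ?L
    show ?R
    proof (intro ballI notI)
      fix i assume "i \<in> M" "Suc i mod n \<in> M"
      then show False
        using L neq[of i] M by blast
    qed
  next
    assume R: ?R
    show ?L
    proof (intro ballI impI)
      fix e f assume ef: "e \<in> M" "f \<in> M" "e \<noteq> f"
      then have "Suc e mod n \<noteq> Suc f mod n"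
        using inj M by blast
      moreover have "Suc e mod n \<noteq> f" "Suc f mod n \<noteq> e"
        using R ef by blast+
      ultimately show "{e, Suc e mod n} \<inter> {f, Suc f mod n} = {}"
        using ef by auto
    qed
  qed
  then show ?thesis
    by (auto simp: matching_def cycle_graph_def)
qed

text \<open>The last edge decides: without it the cycle opens into a path, with it the edges 0 and
  \<open>n - 2\<close> drop out. The total is the Lucas number of index \<open>n\<close>.\<close>

lemma card_matching_cycle_graph:
  assumes "n \<ge> 2"
  shows "card {M. matching (cycle_graph n) M} = fib (n + 1) + fib (n - 1)"
proof -
  obtain m where m: "n = Suc (Suc m)"
    using assms by (metis One_nat_def Suc_1 Suc_le_D Suc_le_mono)
  let ?S = "\<lambda>k n. {M. M \<subseteq> {k..<k + n} \<and> sparse M}"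
  have fin: "finite (?S k n)" for k n
    by (rule finite_subset[of _ "Pow {k..<k + n}"]) auto
  let ?f = "insert (Suc m)"
  have mt: "matching (cycle_graph n) M \<longleftrightarrow>
      M \<subseteq> {..<Suc (Suc m)} \<and> sparse M \<and> (Suc m \<in> M \<longrightarrow> 0 \<notin> M)" for M
  proof -
    have "(\<forall>i\<in>M. Suc i mod n \<notin> M) \<longleftrightarrow> sparse M \<and> (Suc m \<in> M \<longrightarrow> 0 \<notin> M)"
      if sub: "M \<subseteq> {..<n}"
    proof -
      have "Suc i mod n = (if i = Suc m then 0 else Suc i)" if "i \<in> M" for i
        using sub that m by (auto simp: mod_less)
      then have "(\<forall>i\<in>M. Suc i mod n \<notin> M) \<longleftrightarrow> (\<forall>i\<in>M. (if i = Suc m then 0 else Suc i) \<notin> M)"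
        by simp
      moreover have "Suc (Suc m) \<notin> M"
        using sub m by auto
      ultimately show ?thesis
        unfolding sparse_def by (metis (full_types))
    qed
    then show ?thesis
      using m matching_cycle_graph_iff[OF assms] by metis
  qed
  have "{M. matching (cycle_graph n) M \<and> Suc m \<notin> M} = ?S 0 (Suc m)"
    unfolding mt by (fastforce simp: less_Suc_eq)
  then have 1: "card {M. matching (cycle_graph n) M \<and> Suc m \<notin> M} = fib (n + 1)"
    using card_sparse[of 0 "Suc m"] m by simp
  have "{M. matching (cycle_graph n) M \<and> Suc m \<in> M} = ?f ` ?S 1 (m - 1)"
  proof (intro subset_antisym subsetI)
    fix M assume "M \<in> {M. matching (cycle_graph n) M \<and> Suc m \<in> M}"
    then have M: "M \<subseteq> {..<Suc (Suc m)}" "sparse M" "0 \<notin> M" "Suc m \<in> M" "m \<notin> M"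
      unfolding mt by (auto simp: sparse_def)
    have "M - {Suc m} \<in> ?S 1 (m - 1)"
    proof (intro CollectI conjI subsetI)
      fix x assume x: "x \<in> M - {Suc m}"
      then have "x < Suc (Suc m)"
        using M(1) by auto
      moreover have "x \<noteq> 0"
        using x M(3) by (metis DiffD1)
      moreover have "x \<noteq> m"
        using x M(5) by (metis DiffD1)
      ultimately show "x \<in> {1..<1 + (m - 1)}"
        using x by auto
    next
      show "sparse (M - {Suc m})"
        using M(2) by (auto simp: sparse_def)
    qed
    moreover have "M = ?f (M - {Suc m})"
      using M(4) by auto
    ultimately show "M \<in> ?f ` ?S 1 (m - 1)"
      by blast
  next
    fix M assume "M \<in> ?f ` ?S 1 (m - 1)"
    then obtain A where A: "M = ?f A" "A \<subseteq> {1..<1 + (m - 1)}" "sparse A"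
      by auto
    have bounds: "0 < x" "x < m" if "x \<in> A" for x
      using A(2) that by fastforce+
    have "?f A \<subseteq> {..<Suc (Suc m)}"
      by (auto dest: bounds)
    moreover have "sparse (?f A)"
      using A(3) unfolding sparse_def by (auto dest: bounds)
    moreover have "0 \<notin> ?f A"
      by (auto dest: bounds)
    ultimately show "M \<in> {M. matching (cycle_graph n) M \<and> Suc m \<in> M}"
      unfolding mt mem_Collect_eq A(1) by simp
  qed
  moreover have "inj_on ?f (?S 1 (m - 1))"
    by (rule inj_on_insert) auto
  ultimately have "card {M. matching (cycle_graph n) M \<and> Suc m \<in> M} = fib (m - 1 + 2)"
    using card_sparse[of 1 "m - 1"] by (simp add: card_image)
  \<comment> \<open>For \<open>m = 0\<close> the truncated \<open>m - 1\<close> is harmless, because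
    \<open>fib 2 = fib 1\<close>.\<close>
  then have 2: "card {M. matching (cycle_graph n) M \<and> Suc m \<in> M} = fib (n - 1)"
    using m by (cases m) auto
  have fin': "finite {M. matching (cycle_graph n) M \<and> P M}" for P
    by (rule finite_subset[of _ "Pow {..<n}"]) (auto simp: matching_def cycle_graph_def)
  have "{M. matching (cycle_graph n) M} = {M. matching (cycle_graph n) M \<and> Suc m \<notin> M} \<union>
      {M. matching (cycle_graph n) M \<and> Suc m \<in> M}"
    by auto
  then show ?thesis
    using 1 2 by (simp add: card_Un_disjoint fin' disjoint_iff)
qed

text \<open>Each vertex is covered by exactly one of its two incident edges, so membership
  alternates around the cycle and is fixed by edge 0.\<close>

lemma perfect_matching_cycle_graph_iff:
  assumes "d \<ge> 1"
  shows "perfect_matching (cycle_graph (2 * d)) M \<longleftrightarrow>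
    M = {i. i < 2 * d \<and> even i} \<or> M = {i. i < 2 * d \<and> odd i}"
    (is "?P M \<longleftrightarrow> M = ?E \<or> M = ?O")
proof
  let ?n = "2 * d"
  have n2: "?n \<ge> 2"
    using assms by simp
  assume P: "?P M"
  then have M: "M \<subseteq> {..<?n}" "\<forall>i\<in>M. Suc i mod ?n \<notin> M" "(\<Union>i\<in>M. {i, Suc i mod ?n}) = {..<?n}"
    using matching_cycle_graph_iff[OF n2, of M]
    by (auto simp: perfect_matching_def cycle_graph_def)
  have step: "Suc i \<in> M \<longleftrightarrow> i \<notin> M" if "Suc i < ?n" for i
  proof
    show "Suc i \<in> M \<Longrightarrow> i \<notin> M"
      using M(2) that by auto
    assume "i \<notin> M"
    have "Suc i \<in> (\<Union>i\<in>M. {i, Suc i mod ?n})"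
      unfolding M(3) using that by simp
    then obtain j where j: "j \<in> M" "Suc i = j \<or> Suc i = Suc j mod ?n"
      by auto
    moreover have "i = j" if "Suc i = Suc j mod ?n"
      using that by (auto simp: mod_Suc split: if_splits)
        (metis M(1) j(1) lessThan_iff mod_less subsetD)
    ultimately show "Suc i \<in> M"
      using \<open>i \<notin> M\<close> by auto
  qed
  have "i \<in> M \<longleftrightarrow> (even i \<longleftrightarrow> 0 \<in> M)" if "i < ?n" for i
    using that by (induction i) (use step in auto)
  then show "M = ?E \<or> M = ?O"
    using M(1) by (cases "0 \<in> M") auto
next
  let ?n = "2 * d"
  have n2: "?n \<ge> 2"
    using assms by simp
  \<comment> \<open>The parity flips at the wrap-around as well, because the length
    \<open>2 * d\<close> is even.\<close>
  have par: "even (Suc i mod ?n) \<longleftrightarrow> odd i" for i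
    by (simp add: dvd_mod_iff)
  have pre: "\<exists>j<?n. Suc j mod ?n = i" if "i < ?n" for i
  proof (cases i)
    case 0
    then show ?thesis
      using assms by (intro exI[of _ "?n - 1"]) auto
  next
    case (Suc j)
    then show ?thesis
      using that by (intro exI[of _ j]) auto
  qed
  have lt: "Suc i mod ?n < ?n" for i
    using assms by simp
  have cover: "(\<Union>i\<in>{i. i < ?n \<and> Q i}. {i, Suc i mod ?n}) = {..<?n}"
    if "\<And>i. Q (Suc i mod ?n) \<longleftrightarrow> \<not> Q i" for Q
  proof (intro subset_antisym subsetI)
    fix x assume x: "x \<in> {..<?n}"
    show "x \<in> (\<Union>i\<in>{i. i < ?n \<and> Q i}. {i, Suc i mod ?n})"
    proof (cases "Q x")
      case False
      then show ?thesis
        using pre[of x] x that by auto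
    qed (use x in auto)
  qed (use lt in auto)
  assume "M = ?E \<or> M = ?O"
  then show "?P M"
  proof
    assume "M = ?E"
    then show ?thesis
      unfolding perfect_matching_def matching_cycle_graph_iff[OF n2]
      using par cover[of even] by (auto simp: cycle_graph_def)
  next
    assume "M = ?O"
    then show ?thesis
      unfolding perfect_matching_def matching_cycle_graph_iff[OF n2]
      using par cover[of odd] by (auto simp: cycle_graph_def)
  qed
qed

text \<open>Exactly two of the matchings are perfect. Adding 2 on the left avoids truncated
  subtraction.\<close>

lemma num_imperfect_matchings_cycle_graph:
  assumes "d \<ge> 1"
  shows "num_imperfect_matchings (cycle_graph (2 * d)) + 2 = fib (2 * d + 1) + fib (2 * d - 1)"
proof -
  let ?E = "{i. i < 2 * d \<and> even i}" and ?O = "{i. i < 2 * d \<and> odd i}"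
  let ?M = "{M. matching (cycle_graph (2 * d)) M}"
  have fin: "finite ?M"
    by (rule finite_subset[of _ "Pow {..<2 * d}"]) (auto simp: matching_def cycle_graph_def)
  have "0 \<in> ?E" "0 \<notin> ?O"
    using assms by auto
  then have ne: "?E \<noteq> ?O"
    by blast
  have sub: "{?E, ?O} \<subseteq> ?M"
    using perfect_matching_cycle_graph_iff[OF assms] by (auto simp: perfect_matching_def)
  have "{M. matching (cycle_graph (2 * d)) M \<and> \<not> perfect_matching (cycle_graph (2 * d)) M} =
      ?M - {?E, ?O}"
    using perfect_matching_cycle_graph_iff[OF assms] by auto
  then have "num_imperfect_matchings (cycle_graph (2 * d)) = card ?M - card {?E, ?O}"
    unfolding num_imperfect_matchings_def using sub by (simp add: card_Diff_subset)
  moreover have "card {?E, ?O} = 2"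
    using ne by simp
  moreover have "card {?E, ?O} \<le> card ?M"
    using fin sub by (rule card_mono)
  ultimately show ?thesis
    using card_matching_cycle_graph[of "2 * d"] assms by simp
qed

text \<open>This sum is the shape in which the walk around the rim produces the count. Each summand
  is the Lucas number L(2k+1) = L(2k+2) - L(2k), so the sum telescopes to L(2d) - L(0), and L(0) =
  2.\<close>

lemma sum_fib_eq_num_imperfect_matchings:
  assumes "d \<ge> 1"
  shows "(\<Sum>k<d. fib (2 * k) + fib (2 * k + 2)) = num_imperfect_matchings (cycle_graph (2 * d))"
proof -
  obtain n where n: "d = Suc n"
    using assms by (cases d) auto
  have "(\<Sum>k<Suc n. fib (2 * k) + fib (2 * k + 2)) + 2 = fib (2 * Suc n + 1) + fib (2 * Suc n - 1)"
    by (induction n) (auto simp: numeral_eq_Suc)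
  then show ?thesis
    using num_imperfect_matchings_cycle_graph[OF assms] unfolding n by linarith
qed

section \<open>Rooted forests and contraction of edges\<close>

definition conn :: "('v, 'e) ugraph \<Rightarrow> 'e set \<Rightarrow> ('v \<times> 'v) set" where
  "conn G F = (adjacency (G\<lparr>edges := F\<rparr>))\<^sup>*"

lemma conn_refl [simp]: "(x, x) \<in> conn G F"
  by (simp add: conn_def)

lemma conn_trans: "(x, y) \<in> conn G F \<Longrightarrow> (y, z) \<in> conn G F \<Longrightarrow> (x, z) \<in> conn G F"
  unfolding conn_def by (rule rtrancl_trans)

lemma conn_sym: "(x, y) \<in> conn G F \<Longrightarrow> (y, x) \<in> conn G F"
proof -
  have "sym (adjacency (G\<lparr>edges := F\<rparr>))"
    by (auto simp: sym_def adjacency_def insert_commute)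
  then have "sym (conn G F)"
    unfolding conn_def by (rule sym_rtrancl)
  then show "(x, y) \<in> conn G F \<Longrightarrow> (y, x) \<in> conn G F"
    by (meson symD)
qed

lemma conn_mono: "F \<subseteq> F' \<Longrightarrow> conn G F \<subseteq> conn G F'"
  unfolding conn_def by (rule rtrancl_mono) (auto simp: adjacency_def)

lemma conn_empty: "conn G {} = Id"
  by (simp add: conn_def adjacency_def)

lemma conn_edge: "e \<in> F \<Longrightarrow> ends G e = {u, v} \<Longrightarrow> (u, v) \<in> conn G F"
  unfolding conn_def by (rule r_into_rtrancl) (auto simp: adjacency_def)

text \<open>A shortest walk crosses the new edge at most once, in one of its two directions.\<close>

lemma conn_insert:
  assumes "ends G e = {u, v}"
  shows "(x, y) \<in> conn G (insert e F) \<longleftrightarrow>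
    (x, y) \<in> conn G F \<or> (x, u) \<in> conn G F \<and> (v, y) \<in> conn G F \<or>
    (x, v) \<in> conn G F \<and> (u, y) \<in> conn G F" (is "?L \<longleftrightarrow> ?R")
proof
  have "adjacency (G\<lparr>edges := insert e F\<rparr>) =
      insert (u, v) (insert (v, u) (adjacency (G\<lparr>edges := F\<rparr>)))"
    using assms by (auto simp: adjacency_def doubleton_eq_iff)
  then have eq: "conn G (insert e F) =
      (insert (u, v) (insert (v, u) (adjacency (G\<lparr>edges := F\<rparr>))))\<^sup>*"
    by (simp add: conn_def)
  assume ?L
  then show ?R
    unfolding eq rtrancl_insert by (fold conn_def) (auto intro: conn_trans conn_sym)
next
  have "(u, v) \<in> conn G (insert e F)"
    using assms by (intro conn_edge[of e]) auto
  moreover have "conn G F \<subseteq> conn G (insert e F)"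
    by (rule conn_mono) auto
  moreover assume ?R
  ultimately show ?L
    by (meson conn_sym conn_trans subsetD)
qed

text \<open>A walk that returns to a visited vertex is cut back to that visit. This yields the
  distinct vertices that \<open>is_cycle\<close> demands.\<close>

lemma conn_simple_path:
  assumes "(u, v) \<in> conn G F" "F \<subseteq> edges G" "\<forall>e\<in>F. ends G e \<subseteq> verts G" "u \<in> verts G"
  shows "\<exists>n es vs. length vs = Suc n \<and> length es = n \<and> distinct vs \<and> set vs \<subseteq> verts G \<and>
    set es \<subseteq> F \<and> vs ! 0 = u \<and> vs ! n = v \<and> (\<forall>i<n. ends G (es ! i) = {vs ! i, vs ! Suc i})"
  using assms(1) unfolding conn_def
proof (induction rule: rtrancl_induct)
  case base
  show ?case
    using assms(4) by (intro exI[of _ 0] exI[of _ "[]"] exI[of _ "[u]"]) simp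
next
  case (step v w)
  then obtain n es vs where p: "length vs = Suc n" "length es = n" "distinct vs"
      "set vs \<subseteq> verts G" "set es \<subseteq> F" "vs ! 0 = u" "vs ! n = v"
      "\<forall>i<n. ends G (es ! i) = {vs ! i, vs ! Suc i}"
    by blast
  obtain e where e: "e \<in> F" "ends G e = {v, w}"
    using step(2) by (auto simp: adjacency_def)
  show ?case
  proof (cases "w \<in> set vs")
    case True
    then obtain k where k: "k \<le> n" "vs ! k = w"
      using p(1) by (metis in_set_conv_nth less_Suc_eq_le)
    show ?thesis
      using p k
      by (intro exI[of _ k] exI[of _ "take k es"] exI[of _ "take (Suc k) vs"])
        (auto dest: in_set_takeD)
  next
    case False
    show ?thesis
      using p e False assms(3)
      by (intro exI[of _ "Suc n"] exI[of _ "es @ [e]"] exI[of _ "vs @ [w]"])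
        (auto simp: nth_append less_Suc_eq)
  qed
qed

text \<open>The new edge closes a simple path into a cycle; for \<open>u = v\<close> the path has no
  edges and the cycle is a loop.\<close>

lemma cycle_if_conn:
  assumes "(u, v) \<in> conn G F" "F \<subseteq> edges G" "\<forall>e\<in>F. ends G e \<subseteq> verts G" "u \<in> verts G"
    and "e \<notin> F" "ends G e = {u, v}"
  shows "\<not> acyclic_graph (G\<lparr>edges := insert e F\<rparr>)"
proof -
  obtain n es vs where p: "length vs = Suc n" "length es = n" "distinct vs"
      "set vs \<subseteq> verts G" "set es \<subseteq> F" "vs ! 0 = u" "vs ! n = v"
      "\<forall>i<n. ends G (es ! i) = {vs ! i, vs ! Suc i}"
    using conn_simple_path[OF assms(1-4)] by blast
  \<comment> \<open>A repeated edge would have the same endpoints at two positions and so force a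
    repeated vertex.\<close>
  have "distinct es"
    unfolding distinct_conv_nth
  proof (intro allI impI notI)
    fix i j assume ij: "i < length es" "j < length es" "i \<noteq> j" "es ! i = es ! j"
    then have "{vs ! i, vs ! Suc i} = {vs ! j, vs ! Suc j}"
      using p(2,8) by metis
    then show False
      using ij p(1,2,3) by (auto simp: doubleton_eq_iff nth_eq_iff_index_eq)
  qed
  moreover have "ends G ((es @ [e]) ! i) = {vs ! i, vs ! (Suc i mod Suc n)}" if "i < Suc n" for i
  proof (cases "i < n")
    case True
    then have "Suc i mod Suc n = Suc i"
      by (intro mod_less) simp
    then show ?thesis
      using p True by (simp add: nth_append)
  next
    case False
    then have "i = n"
      using that by simp
    then show ?thesis
      using p assms(6) by (simp add: nth_append insert_commute)
  qed
  ultimately have "is_cycle (G\<lparr>edges := insert e F\<rparr>) vs (es @ [e])"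
    using p assms(5) by (auto simp: is_cycle_def)
  then show ?thesis
    by (auto simp: acyclic_graph_def)
qed

text \<open>Any new cycle passes through \<open>e\<close>; the rest of it joins the two ends of
  \<open>e\<close> inside \<open>F\<close>.\<close>

lemma conn_if_cycle:
  assumes "acyclic_graph (G\<lparr>edges := F\<rparr>)" "\<not> acyclic_graph (G\<lparr>edges := insert e F\<rparr>)"
    and "ends G e = {u, v}"
  shows "(u, v) \<in> conn G F"
proof -
  obtain vs es where c: "is_cycle (G\<lparr>edges := insert e F\<rparr>) vs es"
    using assms(2) by (auto simp: acyclic_graph_def)
  let ?n = "length es"
  have ends: "ends G (es ! i) = {vs ! i, vs ! (Suc i mod ?n)}" if "i < ?n" for i
    using c that by (simp add: is_cycle_def)
  have dist: "distinct es" and sub: "set es \<subseteq> insert e F" and ne: "es \<noteq> []"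
    using c by (auto simp: is_cycle_def)
  have "e \<in> set es"
  proof (rule ccontr)
    assume "e \<notin> set es"
    then have "is_cycle (G\<lparr>edges := F\<rparr>) vs es"
      using c by (auto simp: is_cycle_def)
    then show False
      using assms(1) by (auto simp: acyclic_graph_def)
  qed
  then obtain k where k: "k < ?n" "es ! k = e"
    by (metis in_set_conv_nth)
  \<comment> \<open>The walk starts just behind \<open>e\<close> and takes at most
    \<open>?n - 1\<close> steps, too few to traverse the edge at index \<open>k\<close>.\<close>
  have walk: "(vs ! (Suc k mod ?n), vs ! ((Suc k + j) mod ?n)) \<in> conn G F" if "j < ?n" for j
    using that
  proof (induction j)
    case (Suc j)
    let ?i = "(Suc k + j) mod ?n"
    have i: "?i < ?n"
      using ne by simp
    have "?i \<noteq> k"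
    proof
      assume "?i = k"
      then have *: "(k + Suc j) mod ?n = k"
        by simp
      show False
      proof (cases "k + Suc j < ?n")
        case True
        then show False
          using * by (simp add: mod_less)
      next
        case False
        then have "(k + Suc j) mod ?n = k + Suc j - ?n"
          using k(1) Suc.prems by (simp add: le_mod_geq mod_less)
        then show False
          using * Suc.prems False by simp
      qed
    qed
    then have "es ! ?i \<noteq> e"
      using dist k i by (metis nth_eq_iff_index_eq)
    then have "es ! ?i \<in> F"
      using sub i nth_mem by fastforce
    then have "(vs ! ?i, vs ! (Suc ?i mod ?n)) \<in> conn G F"
      using ends[OF i] by (rule conn_edge)
    then show ?case
      using Suc by (auto simp: mod_Suc_eq intro: conn_trans)
  qed simp
  have "(vs ! (Suc k mod ?n), vs ! ((Suc k + (?n - 1)) mod ?n)) \<in> conn G F"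
    using ne by (intro walk) simp
  moreover have "(Suc k + (?n - 1)) mod ?n = k"
    using ne k(1) by simp
  ultimately have "(vs ! (Suc k mod ?n), vs ! k) \<in> conn G F"
    by simp
  moreover have "{u, v} = {vs ! k, vs ! (Suc k mod ?n)}"
    using ends[OF k(1)] k(2) assms(3) by simp
  ultimately show ?thesis
    by (auto simp: doubleton_eq_iff intro: conn_sym)
qed

text \<open>This is the part of being a rooted spanning forest that survives the removal of edges.
  That every vertex reaches a root is tested only after all edges are decided.\<close>

definition rooted_forest :: "('v, 'e) ugraph \<Rightarrow> 'v set \<Rightarrow> 'e set \<Rightarrow> bool" where
  "rooted_forest G R F \<longleftrightarrow> F \<subseteq> edges G \<and> acyclic_graph (G\<lparr>edges := F\<rparr>) \<and>
    (\<forall>x\<in>R. \<forall>y\<in>R. (x, y) \<in> conn G F \<longrightarrow> x = y)"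

text \<open>Connectivity after identifying all vertices of \<open>R\<close>.\<close>

definition rconn :: "('v, 'e) ugraph \<Rightarrow> 'v set \<Rightarrow> 'e set \<Rightarrow> 'v \<Rightarrow> 'v \<Rightarrow> bool" where
  "rconn G R F x y \<longleftrightarrow> (x, y) \<in> conn G F \<or>
    (\<exists>s\<in>R. \<exists>t\<in>R. (x, s) \<in> conn G F \<and> (t, y) \<in> conn G F)"

lemma rconn_if_conn: "(x, y) \<in> conn G F \<Longrightarrow> rconn G R F x y"
  by (simp add: rconn_def)

lemma rconn_sym: "rconn G R F x y \<Longrightarrow> rconn G R F y x"
  unfolding rconn_def using conn_sym by metis

lemma rconn_trans: "rconn G R F x y \<Longrightarrow> rconn G R F y z \<Longrightarrow> rconn G R F x z"
  unfolding rconn_def using conn_trans by metis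

lemma rooted_forest_antimono:
  assumes "rooted_forest G R F'" "F \<subseteq> F'"
  shows "rooted_forest G R F"
proof -
  have "acyclic_graph (G\<lparr>edges := F\<rparr>)"
    using assms by (fastforce simp: rooted_forest_def acyclic_graph_def is_cycle_def)
  then show ?thesis
    using assms conn_mono[OF assms(2), of G] unfolding rooted_forest_def by blast
qed

text \<open>Identifying the roots turns both obstructions, a cycle and a path between two roots,
  into one: the ends of \<open>e\<close> are already connected.\<close>

lemma rooted_forest_insert:
  assumes "rooted_forest G R F" "\<forall>e\<in>edges G. ends G e \<subseteq> verts G"
    and "e \<in> edges G" "e \<notin> F" "ends G e = {u, v}"
  shows "rooted_forest G R (insert e F) \<longleftrightarrow> \<not> rconn G R F u v"
proof
  assume *: "rooted_forest G R (insert e F)"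
  show "\<not> rconn G R F u v"
  proof
    assume "rconn G R F u v"
    then consider "(u, v) \<in> conn G F"
      | s t where "s \<in> R" "t \<in> R" "(u, s) \<in> conn G F" "(t, v) \<in> conn G F"
      by (auto simp: rconn_def)
    then show False
    proof cases
      case 1
      then have "\<not> acyclic_graph (G\<lparr>edges := insert e F\<rparr>)"
        using assms by (intro cycle_if_conn[of u v]) (auto simp: rooted_forest_def)
      then show False
        using * by (simp add: rooted_forest_def)
    next
      \<comment> \<open>\<open>e\<close> would link the roots \<open>s\<close> and \<open>t\<close>;
        hence they coincide, and the two half-paths already join \<open>u\<close> to
        \<open>v\<close> in \<open>F\<close>.\<close>
      case 2
      then have "(s, t) \<in> conn G (insert e F)"
        unfolding conn_insert[OF assms(5)] by (metis conn_sym)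
      then have "s = t"
        using * 2 by (auto simp: rooted_forest_def)
      then have "(u, v) \<in> conn G F"
        using 2 conn_trans by metis
      then have "\<not> acyclic_graph (G\<lparr>edges := insert e F\<rparr>)"
        using assms by (intro cycle_if_conn[of u v]) (auto simp: rooted_forest_def)
      then show False
        using * by (simp add: rooted_forest_def)
    qed
  qed
next
  assume *: "\<not> rconn G R F u v"
  then have "acyclic_graph (G\<lparr>edges := insert e F\<rparr>)"
    using assms conn_if_cycle by (fastforce simp: rooted_forest_def rconn_def)
  moreover have "x = y" if "x \<in> R" "y \<in> R" "(x, y) \<in> conn G (insert e F)" for x y
    using that * assms(1) unfolding conn_insert[OF assms(5)]
    by (auto simp: rooted_forest_def rconn_def dest: conn_sym)
  ultimately show "rooted_forest G R (insert e F)"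
    using assms by (auto simp: rooted_forest_def)
qed

text \<open>As in \<open>conn_insert\<close>, one crossing of \<open>e\<close> is enough after the
  roots are identified.\<close>

lemma rconn_insert:
  assumes "ends G e = {u, v}"
  shows "rconn G R (insert e F) x y \<longleftrightarrow> rconn G R F x y \<or>
    rconn G R F x u \<and> rconn G R F v y \<or> rconn G R F x v \<and> rconn G R F u y"
    (is "_ \<longleftrightarrow> ?Q x y")
proof
  have Q: "?Q x y" if "(x, y) \<in> conn G (insert e F)" for x y
    using that rconn_if_conn unfolding conn_insert[OF assms] by metis
  assume "rconn G R (insert e F) x y"
  then consider "(x, y) \<in> conn G (insert e F)"
    | s t where "s \<in> R" "t \<in> R" "(x, s) \<in> conn G (insert e F)" "(t, y) \<in> conn G (insert e F)"
    by (auto simp: rconn_def)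
  then show "?Q x y"
  proof cases
    \<comment> \<open>\<open>e\<close> may be crossed both before and after the jump between roots;
      two crossings reduce to at most one.\<close>
    case 2
    then have "rconn G R F s t"
      unfolding rconn_def using conn_refl by metis
    then have "?Q x t"
      using Q[OF 2(3)] rconn_trans by metis
    then show ?thesis
      using Q[OF 2(4)] by (elim disjE conjE) (metis rconn_trans rconn_sym)+
  qed (rule Q)
next
  have mono: "rconn G R (insert e F) x y" if "rconn G R F x y" for x y
    using that conn_mono[of F "insert e F" G] unfolding rconn_def by blast
  have "(u, v) \<in> conn G (insert e F)"
    using assms by (intro conn_edge) auto
  then have "rconn G R (insert e F) u v"
    by (rule rconn_if_conn)
  moreover assume "?Q x y"
  ultimately show "rconn G R (insert e F) x y"
    by (meson mono rconn_sym rconn_trans)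
qed

text \<open>Uniqueness of the root of a component goes into \<open>rooted_forest\<close>, existence
  into being joined to the identified roots, for which \<open>\<rho>\<close> stands.\<close>

lemma rooted_spanning_forest_iff:
  assumes "\<rho> \<in> R" "R \<subseteq> verts G"
  shows "rooted_spanning_forest G R F \<longleftrightarrow>
    rooted_forest G R F \<and> (\<forall>x\<in>verts G. rconn G R F x \<rho>)"
proof -
  have 1: "(\<forall>x\<in>verts G. rconn G R F x \<rho>) \<longleftrightarrow> (\<forall>x\<in>verts G. \<exists>s\<in>R. (x, s) \<in> conn G F)"
    using assms by (auto simp: rconn_def) (metis conn_refl)
  have 2: "(\<forall>C\<in>components (G\<lparr>edges := F\<rparr>). \<exists>!v. v \<in> C \<and> v \<in> R) \<longleftrightarrow>
      (\<forall>x\<in>verts G. \<exists>!s. s \<in> R \<and> (x, s) \<in> conn G F)"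
  proof -
    have "(\<exists>!v. v \<in> {v \<in> verts (G\<lparr>edges := F\<rparr>). (x, v) \<in> conn G F} \<and> v \<in> R) \<longleftrightarrow>
        (\<exists>!s. s \<in> R \<and> (x, s) \<in> conn G F)" for x
      using assms(2) by (intro arg_cong[of _ _ Ex1] ext) auto
    then show ?thesis
      by (simp add: components_def conn_def[symmetric] Setcompr_eq_image)
  qed
  have 3: "(\<forall>x\<in>verts G. \<exists>!s. s \<in> R \<and> (x, s) \<in> conn G F) \<longleftrightarrow>
      (\<forall>x\<in>R. \<forall>y\<in>R. (x, y) \<in> conn G F \<longrightarrow> x = y) \<and>
      (\<forall>x\<in>verts G. \<exists>s\<in>R. (x, s) \<in> conn G F)"
    (is "?L \<longleftrightarrow> ?U \<and> ?E")
  proof (intro iffI conjI)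
    assume L: ?L
    then show ?E by blast
    show ?U
    proof (intro ballI impI)
      fix x y assume "x \<in> R" "y \<in> R" "(x, y) \<in> conn G F"
      moreover have "\<exists>!s. s \<in> R \<and> (x, s) \<in> conn G F"
        using L \<open>x \<in> R\<close> assms(2) by blast
      ultimately show "x = y"
        using conn_refl[of x G F] by blast
    qed
  next
    assume UE: "?U \<and> ?E"
    show ?L
    proof (intro ballI ex_ex1I)
      fix x s t assume "s \<in> R \<and> (x, s) \<in> conn G F" "t \<in> R \<and> (x, t) \<in> conn G F"
      moreover from this have "(s, t) \<in> conn G F"
        using conn_sym conn_trans by metis
      ultimately show "s = t"
        using UE by blast
    qed (use UE in blast)
  qed
  show ?thesis
    unfolding rooted_spanning_forest_def rooted_forest_def 1 2 3 by blast
qed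

text \<open>
  Counting by deletion and contraction: the classes of \<open>lab\<close> are the vertices obtained by contracting
  the chosen edges, and the list contains the edges still to be decided.
\<close>

fun tree_count :: "'v set \<Rightarrow> 'v \<Rightarrow> ('v \<Rightarrow> 'v) \<Rightarrow> ('v \<times> 'v) list \<Rightarrow> nat" where
  "tree_count V \<rho> lab [] = (if \<forall>x\<in>V. lab x = lab \<rho> then 1 else 0)"
| "tree_count V \<rho> lab ((u, v) # es) = tree_count V \<rho> lab es +
    (if lab u = lab v then 0
     else tree_count V \<rho> (\<lambda>x. if lab x = lab u then lab v else lab x) es)"

text \<open>Completions without \<open>e\<close> keep the labels; completions with \<open>e\<close>
  exist only if its ends have different labels, which then merge. The invariant is that labels tell
  apart exactly the classes of \<open>rconn\<close>.\<close>

lemma card_rooted_spanning_forests_extending: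
  assumes G: "\<forall>e\<in>edges G. ends G e \<subseteq> verts G"
    and R: "\<rho> \<in> R" "R \<subseteq> verts G"
    and "rooted_forest G R F"
    and "\<forall>x\<in>verts G. \<forall>y\<in>verts G. lab x = lab y \<longleftrightarrow> rconn G R F x y"
    and "distinct es" "set es \<subseteq> edges G - F"
    and "\<forall>e\<in>set es. ends G e = {fst (p e), snd (p e)}"
  shows "card {A. A \<subseteq> set es \<and> rooted_spanning_forest G R (F \<union> A)} =
    tree_count (verts G) \<rho> lab (map p es)"
  using assms(4-)
proof (induction es arbitrary: F lab)
  case Nil
  have "{A. A \<subseteq> set [] \<and> rooted_spanning_forest G R (F \<union> A)} =
      (if rooted_spanning_forest G R F then {{}} else {})"
    by auto
  moreover have "rooted_spanning_forest G R F \<longleftrightarrow> (\<forall>x\<in>verts G. lab x = lab \<rho>)"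
    using Nil.prems R by (auto simp: rooted_spanning_forest_iff)
  ultimately show ?case
    by simp
next
  case (Cons e es)
  let ?S = "\<lambda>F. {A. A \<subseteq> set es \<and> rooted_spanning_forest G R (F \<union> A)}"
  obtain u v where p: "p e = (u, v)"
    by fastforce
  have e: "e \<in> edges G" "e \<notin> F" "e \<notin> set es" "ends G e = {u, v}"
    using Cons.prems p by auto
  then have uv: "u \<in> verts G" "v \<in> verts G"
    using G by auto
  have fin: "finite (?S F)" for F
    by (rule finite_subset[of _ "Pow (set es)"]) auto
  have "{A. A \<subseteq> set (e # es) \<and> rooted_spanning_forest G R (F \<union> A)} =
      ?S F \<union> insert e ` ?S (insert e F)" (is "?X = ?Y")
  proof (intro subset_antisym subsetI)
    fix A assume A: "A \<in> ?X"
    show "A \<in> ?Y"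
    proof (cases "e \<in> A")
      case True
      then have eq: "A = insert e (A - {e})" "insert e F \<union> (A - {e}) = F \<union> A"
        by auto
      have "A - {e} \<in> ?S (insert e F)"
        unfolding mem_Collect_eq eq(2) using A by auto
      then show ?thesis
        using eq(1) by blast
    qed (use A in auto)
  qed auto
  moreover have "card (insert e ` ?S (insert e F)) = card (?S (insert e F))"
    using e(3) by (intro card_image inj_onI) (auto simp: insert_ident subset_iff)
  moreover have "?S F \<inter> insert e ` ?S (insert e F) = {}"
    using e(3) by auto
  ultimately have card: "card ?X = card (?S F) + card (?S (insert e F))"
    by (simp add: card_Un_disjoint fin)
  have 1: "card (?S F) = tree_count (verts G) \<rho> lab (map p es)"
    using Cons.prems by (intro Cons.IH) auto
  have forest: "rooted_forest G R (insert e F) \<longleftrightarrow> lab u \<noteq> lab v"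
    using rooted_forest_insert[OF Cons.prems(1) G e(1,2,4)] Cons.prems(2) uv by simp
  show ?case
  proof (cases "lab u = lab v")
    case True
    then have "\<not> rooted_forest G R (insert e F \<union> A)" for A
      using forest rooted_forest_antimono[of G R "insert e F \<union> A" "insert e F"] by auto
    then have "?S (insert e F) = {}"
      using R by (auto simp: rooted_spanning_forest_iff)
    then have "card (?S (insert e F)) = 0"
      by (simp only: card.empty)
    then show ?thesis
      unfolding card using 1 p True by simp
  next
    case False
    let ?lab = "\<lambda>x. if lab x = lab u then lab v else lab x"
    have "card (?S (insert e F)) = tree_count (verts G) \<rho> ?lab (map p es)"
    proof (rule Cons.IH)
      show "rooted_forest G R (insert e F)"
        using forest False by simp
      show "\<forall>x\<in>verts G. \<forall>y\<in>verts G. ?lab x = ?lab y \<longleftrightarrow> rconn G R (insert e F) x y"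
        unfolding rconn_insert[OF e(4)] using Cons.prems(2) uv by (metis (full_types))
    qed (use Cons.prems in auto)
    then show ?thesis
      unfolding card using 1 p False by simp
  qed
qed

lemma num_rooted_spanning_forests_eq_tree_count:
  assumes "\<forall>e\<in>edges G. ends G e \<subseteq> verts G" "\<rho> \<in> R" "R \<subseteq> verts G"
    and "distinct es" "set es = edges G"
    and "\<forall>e\<in>set es. ends G e = {fst (p e), snd (p e)}"
  shows "num_rooted_spanning_forests G R =
    tree_count (verts G) \<rho> (\<lambda>x. if x \<in> R then \<rho> else x) (map p es)"
proof -
  have "rooted_forest G R {}"
    by (auto simp: rooted_forest_def acyclic_graph_def is_cycle_def conn_empty)
  moreover have "\<forall>x\<in>verts G. \<forall>y\<in>verts G.
      (if x \<in> R then \<rho> else x) = (if y \<in> R then \<rho> else y) \<longleftrightarrow> rconn G R {} x y"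
    using assms(2) by (auto simp: rconn_def conn_empty)
  ultimately have "card {A. A \<subseteq> set es \<and> rooted_spanning_forest G R ({} \<union> A)} =
      tree_count (verts G) \<rho> (\<lambda>x. if x \<in> R then \<rho> else x) (map p es)"
    using assms by (intro card_rooted_spanning_forests_extending) simp_all
  moreover have "{A. A \<subseteq> set es \<and> rooted_spanning_forest G R A} = {F. rooted_spanning_forest G R F}"
    using assms(5) by (auto simp: rooted_spanning_forest_def)
  ultimately show ?thesis
    by (simp add: num_rooted_spanning_forests_def)
qed

text \<open>A class that no remaining edge touches can never merge with the root class.\<close>

lemma tree_count_eq_0:
  assumes "x \<in> V" "lab x \<noteq> lab \<rho>" "\<forall>(u, v)\<in>set es. lab u \<noteq> lab x \<and> lab v \<noteq> lab x"
  shows "tree_count V \<rho> lab es = 0"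
  using assms(2,3)
proof (induction es arbitrary: lab)
  case Nil
  then show ?case
    using assms(1) by auto
next
  case (Cons e es)
  obtain u v where e: "e = (u, v)"
    by fastforce
  let ?lab = "\<lambda>x. if lab x = lab u then lab v else lab x"
  have uv: "lab u \<noteq> lab x" "lab v \<noteq> lab x"
    using Cons.prems e by auto
  have "tree_count V \<rho> ?lab es = 0"
  proof (rule Cons.IH)
    show "\<forall>(a, b)\<in>set es. ?lab a \<noteq> ?lab x \<and> ?lab b \<noteq> ?lab x"
    proof (rule ballI)
      fix f assume f: "f \<in> set es"
      obtain a b where ab: "f = (a, b)"
        by fastforce
      then have "lab a \<noteq> lab x" "lab b \<noteq> lab x"
        using Cons.prems(2) f by auto
      then show "case f of (a, b) \<Rightarrow> ?lab a \<noteq> ?lab x \<and> ?lab b \<noteq> ?lab x"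
        using ab uv by simp
    qed
  qed (use Cons.prems(1) uv in auto)
  moreover have "tree_count V \<rho> lab es = 0"
    using Cons.prems by (intro Cons.IH) auto
  ultimately show ?case
    by (simp add: e)
qed

section \<open>Walking around the rim\<close>

text \<open>\<open>w\<close> lists the rim in walking order and \<open>I\<close> holds the positions
  of the roots. Position \<open>N\<close> repeats position 0, so the last arc ends at a root like
  every other.\<close>

locale wheel_walk =
  fixes w :: "nat \<Rightarrow> 'v" and c :: 'v and N :: nat and I :: "nat set"
  assumes inj_w: "inj_on w {..<N}" and w_N: "w N = w 0" and w_neq_c: "w i \<noteq> c"
    and N_in_I: "N \<in> I"
begin

definition V :: "'v set" where
  "V = insert c (w ` {..<N})"

text \<open>The spoke precedes the rim edge leaving the same vertex, so once the walk has left a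
  vertex other than \<open>w 0\<close>, none of its edges is undecided.\<close>

definition steps :: "nat \<Rightarrow> ('v \<times> 'v) list" where
  "steps k = concat (map (\<lambda>i. [(c, w i), (w i, w (Suc i))]) [k..<N])"

text \<open>
  The last two clauses say that every vertex left behind is joined to a root, to \<open>c\<close> or to the current
  vertex (otherwise no completion exists), and that the non-roots ahead are still isolated.
\<close>

definition admissible :: "('v \<Rightarrow> 'v) \<Rightarrow> nat \<Rightarrow> bool" where
  "admissible lab k \<longleftrightarrow> (\<forall>i\<in>I. lab (w i) = lab (w 0)) \<and>
    (\<forall>i<k. lab (w i) \<in> {lab (w 0), lab c, lab (w k)}) \<and>
    (\<forall>j. k < j \<and> j < N \<and> j \<notin> I \<longrightarrow> (\<forall>x\<in>V. x \<noteq> w j \<longrightarrow> lab x \<noteq> lab (w j)))"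

abbreviation count :: "('v \<Rightarrow> 'v) \<Rightarrow> ('v \<times> 'v) list \<Rightarrow> nat" where
  "count \<equiv> tree_count V (w 0)"

text \<open>
  Number of completions when the walk has reached \<open>w k\<close>, the next root lies \<open>n\<close> steps ahead, and
  from that root on there are \<open>A\<close> completions if \<open>c\<close> is not yet joined to the roots and \<open>B\<close> if it is.
  In \<open>rim_value\<close> the spoke at \<open>w k\<close> has already been decided and \<open>n + 1\<close> steps remain.
\<close>

definition spoke_value :: "nat \<Rightarrow> nat \<Rightarrow> nat \<Rightarrow> ('v \<Rightarrow> 'v) \<Rightarrow> nat \<Rightarrow> nat" where
  "spoke_value A B n lab k =
    (if lab (w k) = lab (w 0) then
       if lab c = lab (w 0) then fib (2 * n) * B
       else fib (2 * n) * A + (\<Sum>i<n. fib (2 * i) + fib (2 * i + 2)) * B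
     else if lab c = lab (w 0) then fib (2 * n + 1) * B
     else if lab (w k) = lab c then fib (2 * n) * A + fib (2 * n - 1) * B
     else fib (2 * n + 1) * A + fib (2 * n) * B)"

definition rim_value :: "nat \<Rightarrow> nat \<Rightarrow> nat \<Rightarrow> ('v \<Rightarrow> 'v) \<Rightarrow> nat \<Rightarrow> nat" where
  "rim_value A B n lab k =
    (if lab (w k) = lab (w 0) then
       if lab c = lab (w 0) then fib (2 * n + 2) * B
       else fib (2 * n + 2) * A + ((\<Sum>i<n. fib (2 * i) + fib (2 * i + 2)) + fib (2 * n)) * B
     else if lab c = lab (w 0) then fib (2 * n + 1) * B
     else if lab (w k) = lab c then fib (2 * n + 2) * A + fib (2 * n + 1) * B
     else fib (2 * n + 1) * A + fib (2 * n) * B)"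

section \<open>Invariants of the walk\<close>

lemma steps_Cons: "k < N \<Longrightarrow> steps k = (c, w k) # (w k, w (Suc k)) # steps (Suc k)"
  by (simp add: steps_def upt_conv_Cons)

lemma w_in_V: "i \<le> N \<Longrightarrow> N > 0 \<Longrightarrow> w i \<in> V"
  using w_N by (cases "i = N") (auto simp: V_def)

lemma c_in_V: "c \<in> V"
  by (simp add: V_def)

lemma w_neq: "i < j \<Longrightarrow> j < N \<Longrightarrow> w i \<noteq> w j"
  using inj_w by (auto simp: inj_on_def)

lemma admissible_root: "admissible lab k \<Longrightarrow> i \<in> I \<Longrightarrow> lab (w i) = lab (w 0)"
  by (simp add: admissible_def)

lemma admissible_fresh:
  "admissible lab k \<Longrightarrow> k < j \<Longrightarrow> j < N \<Longrightarrow> j \<notin> I \<Longrightarrow> x \<in> V \<Longrightarrow> x \<noteq> w j \<Longrightarrow> lab x \<noteq> lab (w j)"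
  by (auto simp: admissible_def)

text \<open>Common core of contracting a spoke (\<open>u = c\<close>, \<open>k' = k\<close>) and a
  rim edge (\<open>u = w k\<close>, \<open>k' = Suc k\<close>). The merged class takes the label of
  the new current vertex, and no isolated vertex ahead is touched.\<close>

lemma admissible_merge:
  assumes "admissible lab k" "k \<le> k'" "\<And>i. i < k' \<Longrightarrow> lab (w i) \<in> {lab (w 0), lab c, lab (w k'), lab u}"
    and "lab u \<in> {lab (w k), lab c}" "v = w k'" "u \<in> V" "k' \<le> N" "N > 0" "u = c \<or> u = w k"
  shows "admissible (\<lambda>x. if lab x = lab u then lab v else lab x) k'"
  unfolding admissible_def
proof (intro conjI allI impI ballI)
  let ?lab = "\<lambda>x. if lab x = lab u then lab v else lab x"
  fix j x assume j: "k' < j \<and> j < N \<and> j \<notin> I" and x: "x \<in> V" "x \<noteq> w j"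
  have "u \<noteq> w j" "v \<noteq> w j"
    using assms j w_neq w_neq_c by (metis order_le_less_trans)+
  moreover have "v \<in> V"
    using assms w_in_V by simp
  moreover have "lab y \<noteq> lab (w j)" if "y \<in> V" "y \<noteq> w j" for y
    using admissible_fresh[OF assms(1), of j y] j assms(2) that by simp
  ultimately have "lab u \<noteq> lab (w j)" "lab v \<noteq> lab (w j)" "lab x \<noteq> lab (w j)"
    using x assms(6) by auto
  then show "?lab x \<noteq> ?lab (w j)"
    by auto
next
  let ?lab = "\<lambda>x. if lab x = lab u then lab v else lab x"
  fix i assume "i < k'"
  then show "?lab (w i) \<in> {?lab (w 0), ?lab c, ?lab (w k')}"
    using assms(3)[of i] assms(5) by auto
qed (use admissible_root[OF assms(1)] in auto)

lemma admissible_spoke: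
  assumes "admissible lab k" "k < N"
  shows "admissible (\<lambda>x. if lab x = lab c then lab (w k) else lab x) k"
  using assms c_in_V by (intro admissible_merge[of lab k k c]) (auto simp: admissible_def)

lemma admissible_rim:
  assumes "admissible lab k" "k < N"
  shows "admissible (\<lambda>x. if lab x = lab (w k) then lab (w (Suc k)) else lab x) (Suc k)"
  using assms w_in_V
  by (intro admissible_merge[of lab k "Suc k" "w k"]) (auto simp: admissible_def less_Suc_eq)

lemma admissible_Suc:
  assumes "admissible lab k" "lab (w k) \<in> {lab (w 0), lab c}"
  shows "admissible lab (Suc k)"
  using assms unfolding admissible_def by (auto simp: less_Suc_eq)

text \<open>The class of \<open>w k\<close> is stranded: roots ahead carry the root label and other
  vertices ahead are still isolated, so no remaining edge meets it.\<close>

lemma count_eq_0: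
  assumes "admissible lab k" "k < N" "lab (w k) \<notin> {lab (w 0), lab c, lab (w (Suc k))}"
  shows "count lab (steps (Suc k)) = 0"
proof (rule tree_count_eq_0[of "w k"])
  have "lab (w j) \<noteq> lab (w k)" if "Suc k \<le> j" "j \<le> N" for j
  proof (cases "j = Suc k \<or> j \<in> I")
    case True
    then show ?thesis
      using assms admissible_root[OF assms(1), of j] by auto
  next
    case False
    then have "j < N"
      using that N_in_I by (cases "j = N") auto
    then show ?thesis
      using admissible_fresh[OF assms(1), of j "w k"] False that assms(2) w_neq[of k j] w_in_V
      by auto
  qed
  then show "\<forall>(u, v)\<in>set (steps (Suc k)). lab u \<noteq> lab (w k) \<and> lab v \<noteq> lab (w k)"
    using assms(3) by (auto simp: steps_def)
qed (use assms w_in_V in auto)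

lemma count_rim_root:
  assumes "\<And>lab. admissible lab (Suc k) \<Longrightarrow>
      count lab (steps (Suc k)) = (if lab c = lab (w 0) then B else A)"
    and "Suc k \<in> I" "admissible lab k" "k < N"
  shows "count lab ((w k, w (Suc k)) # steps (Suc k)) = rim_value A B 0 lab k"
proof -
  have root: "lab (w (Suc k)) = lab (w 0)"
    using admissible_root assms(2,3) by blast
  show ?thesis
  proof (cases "lab (w k) \<in> {lab (w 0), lab c}")
    case True
    then show ?thesis
      using assms(1)[OF admissible_Suc[OF assms(3) True]] assms(1)[OF admissible_rim[OF assms(3,4)]] root
      by (auto simp: rim_value_def)
  next
    \<comment> \<open>Omitting the rim edge would strand \<open>w k\<close>, so only the contraction
      contributes.\<close>
    case False
    then show ?thesis
      using count_eq_0[OF assms(3,4)] assms(1)[OF admissible_rim[OF assms(3,4)]] root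
      by (auto simp: rim_value_def)
  qed
qed

text \<open>Inside an arc the next vertex is still isolated, so the rim edge can always be
  contracted; omitting it makes the next vertex start afresh.\<close>

lemma count_rim_Suc:
  assumes "\<And>lab. admissible lab (Suc k) \<Longrightarrow> count lab (steps (Suc k)) = spoke_value A B n lab (Suc k)"
    and "Suc k \<notin> I" "admissible lab k" "k < N" "n > 0"
  shows "count lab ((w k, w (Suc k)) # steps (Suc k)) = rim_value A B n lab k"
proof -
  have k: "Suc k < N"
    using assms(2,4) N_in_I by (cases "Suc k = N") auto
  have fresh: "lab (w 0) \<noteq> lab (w (Suc k))" "lab c \<noteq> lab (w (Suc k))" "lab (w k) \<noteq> lab (w (Suc k))"
    using admissible_fresh[OF assms(3), of "Suc k"] assms(2) k w_in_V c_in_V w_neq w_neq_c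
    by (auto simp: less_Suc_eq dest!: spec)
  \<comment> \<open>Writing \<open>n\<close> as a successor resolves the truncated
    \<open>2 * n - 1\<close> in \<open>spoke_value\<close>.\<close>
  obtain m where n: "n = Suc m"
    using assms(5) by (cases n) auto
  show ?thesis
  proof (cases "lab (w k) \<in> {lab (w 0), lab c}")
    case True
    then show ?thesis
      using assms(1)[OF admissible_Suc[OF assms(3) True]] assms(1)[OF admissible_rim[OF assms(3,4)]] fresh
      by (auto simp: rim_value_def spoke_value_def n algebra_simps)
  next
    case False
    then show ?thesis
      using count_eq_0[OF assms(3,4)] assms(1)[OF admissible_rim[OF assms(3,4)]] fresh
      by (auto simp: rim_value_def spoke_value_def n algebra_simps)
  qed
qed

text \<open>Omitting and contracting the spoke add up by the Fibonacci recurrence. If the current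
  vertex is joined to the roots but the center is not, contraction completes the next summand of the
  sum in \<open>spoke_value\<close>.\<close>

lemma count_spoke:
  assumes "\<And>lab. admissible lab k \<Longrightarrow>
      count lab ((w k, w (Suc k)) # steps (Suc k)) = rim_value A B n lab k"
    and "admissible lab k" "k < N"
  shows "count lab (steps k) = spoke_value A B (Suc n) lab k"
  \<comment> \<open>Fixing the first end to \<open>c\<close> unfolds the spoke alone and leaves the
    rim edge for the hypothesis.\<close>
  unfolding steps_Cons[OF assms(3)] tree_count.simps(2)[of _ _ _ c]
  using assms(1)[OF assms(2)] assms(1)[OF admissible_spoke[OF assms(2,3)]]
  by (auto simp: rim_value_def spoke_value_def algebra_simps simp del: tree_count.simps)

lemma count_segment:
  assumes "\<And>lab. admissible lab q \<Longrightarrow> count lab (steps q) = (if lab c = lab (w 0) then B else A)"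
    and "q \<in> I" "q \<le> N" "k + Suc n = q" "\<And>j. k < j \<Longrightarrow> j < q \<Longrightarrow> j \<notin> I" "admissible lab k"
  shows "count lab (steps k) = spoke_value A B (Suc n) lab k"
  using assms(4-)
proof (induction n arbitrary: k lab)
  case 0
  show ?case
  proof (rule count_spoke)
    show "count lab ((w k, w (Suc k)) # steps (Suc k)) = rim_value A B 0 lab k"
      if "admissible lab k" for lab
      using that 0 assms(1-3) by (intro count_rim_root) auto
  qed (use 0 assms(3) in auto)
next
  case (Suc n)
  have "Suc k \<notin> I"
    using Suc.prems by auto
  moreover have "count lab (steps (Suc k)) = spoke_value A B (Suc n) lab (Suc k)"
    if "admissible lab (Suc k)" for lab
    using that Suc.prems by (intro Suc.IH) auto
  ultimately have "count lab ((w k, w (Suc k)) # steps (Suc k)) = rim_value A B (Suc n) lab k"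
    if "admissible lab k" for lab
    using that Suc.prems assms(3) by (intro count_rim_Suc) auto
  then show ?case
    using Suc.prems assms(3) by (intro count_spoke) auto
qed

text \<open>At a root the only information left is whether the center is joined to the roots. If so,
  all later arcs keep the two apart; otherwise exactly one arc, number \<open>l\<close>, joins
  them.\<close>

lemma count_from_root:
  assumes "strict_mono_on {1..Suc r} b" "I = b ` {1..Suc r}" "b (Suc r) = N" "N > 0"
    and "1 \<le> i" "i \<le> Suc r" "admissible lab (b i)"
  shows "count lab (steps (b i)) =
    (if lab c = lab (w 0) then \<Prod>j = i..r. fib (2 * (b (Suc j) - b j))
     else \<Sum>l = i..r. (\<Sum>k<b (Suc l) - b l. fib (2 * k) + fib (2 * k + 2)) *
       (\<Prod>j \<in> {i..r} - {l}. fib (2 * (b (Suc j) - b j))))"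
  using assms(6,5,7)
proof (induction i arbitrary: lab rule: inc_induct)
  case base
  \<comment> \<open>At the end every vertex is in the class of the roots or of \<open>c\<close>, so
    the tree is complete exactly if these agree. This matches the empty product 1 and the empty sum
    0.\<close>
  have "lab (w i) \<in> {lab (w 0), lab c}" if "i < N" for i
    using base(2) assms(3) w_N that by (auto simp: admissible_def)
  then have *: "lab x \<in> {lab (w 0), lab c}" if "x \<in> V" for x
    using that unfolding V_def by blast
  have "(\<forall>x\<in>V. lab x = lab (w 0)) \<longleftrightarrow> lab c = lab (w 0)"
    using c_in_V * by (metis insertE singletonD)
  then show ?case
    by (simp add: steps_def assms(3))
next
  case (step i)
  let ?f = "\<lambda>j. fib (2 * (b (Suc j) - b j))"
  let ?t = "\<lambda>l. \<Sum>k<b (Suc l) - b l. fib (2 * k) + fib (2 * k + 2)"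
  have i: "1 \<le> i" "i \<le> r"
    using step by auto
  then have "b i < b (Suc i)"
    using assms(1) by (auto simp: strict_mono_on_def)
  then obtain n where n: "b i + Suc n = b (Suc i)"
    by (metis add_Suc_right less_imp_Suc_add)
  then have n': "b (Suc i) - b i = Suc n"
    by simp
  have between: "j \<notin> I" if "b i < j" "j < b (Suc i)" for j
  proof
    assume "j \<in> I"
    then obtain l where l: "l \<in> {1..Suc r}" "j = b l"
      using assms(2) by auto
    then have "i < l" "l < Suc i"
      using that i strict_mono_on_less[OF assms(1), of i l] strict_mono_on_less[OF assms(1), of l "Suc i"]
      by auto
    then show False
      by simp
  qed
  have root: "lab (w (b i)) = lab (w 0)"
    using step.prems i assms(2) by (intro admissible_root) auto
  have "b (Suc i) \<le> N"
    using i assms(3) strict_mono_on_leD[OF assms(1), of "Suc i" "Suc r"] by auto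
  then have count: "count lab (steps (b i)) = spoke_value (\<Sum>l = Suc i..r. ?t l * (\<Prod>j \<in> {Suc i..r} - {l}. ?f j))
      (\<Prod>j = Suc i..r. ?f j) (Suc n) lab (b i)"
    using i n between step assms(2) by (intro count_segment) auto
  have split: "{i..r} = insert i {Suc i..r}"
    using i by auto
  have "{i..r} - {i} = {Suc i..r}"
    by auto
  moreover have "(\<Prod>j \<in> {i..r} - {l}. ?f j) = ?f i * (\<Prod>j \<in> {Suc i..r} - {l}. ?f j)"
    if "l \<in> {Suc i..r}" for l
  proof -
    have "{i..r} - {l} = insert i ({Suc i..r} - {l})"
      using that i by auto
    then show ?thesis
      by simp
  qed
  \<comment> \<open>In the term \<open>l = i\<close> the current arc joins the center to the roots;
    the other terms leave that to a later arc.\<close>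
  ultimately have "(\<Sum>l = i..r. ?t l * (\<Prod>j \<in> {i..r} - {l}. ?f j)) =
      ?t i * (\<Prod>j = Suc i..r. ?f j) + ?f i * (\<Sum>l = Suc i..r. ?t l * (\<Prod>j \<in> {Suc i..r} - {l}. ?f j))"
    by (subst (1) split) (simp add: sum_distrib_left ac_simps)
  moreover have "(\<Prod>j = i..r. ?f j) = ?f i * (\<Prod>j = Suc i..r. ?f j)"
    by (subst split) simp
  ultimately show ?case
    unfolding count spoke_value_def n'[symmetric] using root by simp
qed

lemma admissible_initial:
  assumes "I \<subseteq> {..N}" "0 \<in> I"
  shows "admissible (\<lambda>x. if x \<in> w ` I then w 0 else x) 0"
proof -
  \<comment> \<open>Only the positions 0 and \<open>N\<close> share a vertex, and \<open>j\<close>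
    is neither.\<close>
  have "w j \<notin> w ` I" if j: "0 < j" "j < N" "j \<notin> I" for j
  proof
    assume "w j \<in> w ` I"
    then obtain i where i: "i \<in> I" "w j = w i"
      by auto
    then have "i < N \<or> i = N"
      using assms(1) by auto
    then show False
      using i j w_N w_neq[of 0 j] w_neq[of i j] w_neq[of j i] by (metis linorder_neqE_nat)
  qed
  moreover have "w 0 \<noteq> w j" if "0 < j" "j < N" for j
    using w_neq that by blast
  ultimately show ?thesis
    using assms(2) unfolding admissible_def by auto
qed

end

section \<open>The wheel unrolled from its first root\<close>

lemma inj_on_add_mod: "inj_on (\<lambda>k. (x + k) mod n) {..<n}" for n :: nat
proof (rule inj_onI)
  fix k l assume kl: "k \<in> {..<n}" "l \<in> {..<n}" "(x + k) mod n = (x + l) mod n"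
  then have "int n dvd int k - int l"
    by (metis add_diff_cancel_left mod_eq_dvd_iff of_nat_add of_nat_mod)
  moreover have "\<bar>int k - int l\<bar> < int n"
    using kl by auto
  ultimately show "k = l"
    using dvd_imp_le_int[of "int k - int l" "int n"] by fastforce
qed

lemma distinct_alternating:
  "inj_on u {..<n} \<Longrightarrow> distinct (concat (map (\<lambda>i. [Spoke (u i), Rim_Edge (u i)]) [0..<n]))"
proof (induction n)
  case (Suc n)
  have "u n \<notin> u ` {..<n}"
    using Suc.prems by (fastforce simp: inj_on_def)
  moreover have "inj_on u {..<n}"
    using Suc.prems by (rule inj_on_subset) auto
  ultimately show ?case
    using Suc.IH by auto
qed simp

text \<open>The orientation agrees with that of \<open>steps\<close>, so the edge list of the wheel
  maps onto it literally.\<close>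

fun wheel_edge_pair :: "nat \<Rightarrow> wheel_edge \<Rightarrow> wheel_vertex \<times> wheel_vertex" where
  "wheel_edge_pair N (Rim_Edge i) = (Rim i, Rim (if i = N then 1 else i + 1))"
| "wheel_edge_pair N (Spoke i) = (Center, Rim i)"

lemma ends_wheel_graph:
  "ends (wheel_graph N) e = {fst (wheel_edge_pair N e), snd (wheel_edge_pair N e)}"
  by (cases e) (auto simp: wheel_graph_def)

theorem corollary3p8:
  fixes N r :: nat and a d :: "nat \<Rightarrow> nat" and R :: "wheel_vertex set"
  assumes "N \<ge> 3" and "1 \<le> r" and "r \<le> N"
    and "strict_mono_on {1..r} a" and "a ` {1..r} \<subseteq> {1..N}"
    and "R = (\<lambda>i. Rim (a i)) ` {1..r}"
    and "\<forall>i\<in>{1..r}. d i = cyclic_interval N r a i"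
  shows "num_rooted_spanning_forests (wheel_graph N) R =
    (\<Sum>i = 1..r. num_imperfect_matchings (cycle_graph (2 * d i)) *
      (\<Prod>j \<in> {1..r} - {i}. num_matchings (path_graph (2 * d j - 1))))"
proof -
  \<comment> \<open>\<open>u k\<close> is the rim index reached \<open>k\<close> steps after the
    first root; the shifts by 1 pass between \<open>{1..N}\<close> and residues modulo
    \<open>N\<close>.\<close>
  define u where "u k = (a 1 - 1 + k) mod N + 1" for k
  define w where "w k = Rim (u k)" for k
  \<comment> \<open>\<open>b i\<close> is the walking distance from the first root to the
    \<open>i\<close>-th. The extra value \<open>N\<close> at \<open>Suc r\<close> is a full round,
    so the last cyclic interval is a difference of consecutive values too.\<close>
  define b where "b i = (if i \<le> r then a i - a 1 else N)" for i
  define I where "I = b ` {1..Suc r}"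
  define es where "es = concat (map (\<lambda>i. [Spoke (u i), Rim_Edge (u i)]) [0..<N])"

  have a: "1 \<le> a i" "a i \<le> N" if "1 \<le> i" "i \<le> r" for i
    using assms(5) that by (simp_all add: image_subset_iff)
  have a_less: "a i < a j" if "1 \<le> i" "i < j" "j \<le> r" for i j
    using assms(4) that by (auto simp: strict_mono_on_def)
  have a1: "a 1 \<le> a i" if "1 \<le> i" "i \<le> r" for i
    using a_less[of 1 i] that by (cases "i = 1") auto

  have inj_u: "inj_on u {..<N}"
    using inj_on_add_mod[of "a 1 - 1" N] by (simp only: inj_on_def u_def add_right_cancel)
  have u_range: "u ` {..<N} = {1..N}"
  proof (rule card_subset_eq)
    show "u ` {..<N} \<subseteq> {1..N}"
      using assms(1) by (auto simp: u_def Suc_le_eq)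
  qed (use inj_u in \<open>simp_all add: card_image\<close>)
  have u_Suc: "u (Suc k) = (if u k = N then 1 else u k + 1)" for k
    by (simp add: u_def mod_Suc)
  have w_b: "w (b i) = Rim (a i)" if "1 \<le> i" "i \<le> r" for i
    using a[OF that] a1[OF that] a[of 1] assms(2) that by (simp add: w_def u_def b_def)
  have w_N: "w N = w 0"
    by (simp add: w_def u_def)
  have b_1: "b 1 = 0" and b_r: "b (Suc r) = N"
    using assms(2) by (auto simp: b_def)

  interpret wheel_walk w Center N I
  proof
    show "inj_on w {..<N}"
      using inj_u by (auto simp: w_def inj_on_def)
    show "N \<in> I"
      using b_r unfolding I_def by force
  qed (use w_N in \<open>simp_all add: w_def\<close>)

  have b_less: "b i < b j" if "1 \<le> i" "i < j" "j \<le> Suc r" for i j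
  proof (cases "j \<le> r")
    case True
    then show ?thesis
      using that a_less[of i j] a1[of i] by (auto simp: b_def)
  next
    case False
    then show ?thesis
      using that a[of 1] a[of i] by (auto simp: b_def)
  qed
  then have mono_b: "strict_mono_on {1..Suc r} b"
    by (auto simp: strict_mono_on_def)
  have b_diff: "b (Suc j) - b j = d j" if "j \<in> {1..r}" for j
    using that assms(7) a1[of j] a[of j] by (auto simp: b_def cyclic_interval_def)
  have d_pos: "d j \<ge> 1" if "j \<in> {1..r}" for j
    using b_diff[OF that] b_less[of j "Suc j"] that by auto

  have zero_in_I: "0 \<in> I"
    using b_1 unfolding I_def by force
  have R: "R = w ` I"
  proof -
    have "w ` I = insert (w N) ((w \<circ> b) ` {1..r})"
      unfolding I_def using b_r by (simp add: atLeastAtMostSuc_conv image_comp)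
    also have "(w \<circ> b) ` {1..r} = R"
      unfolding assms(6) by (intro image_cong) (auto simp: w_b)
    also have "w N = Rim (a 1)"
      using w_N w_b[of 1] b_1 assms(2) by simp
    also have "insert (Rim (a 1)) R = R"
      using assms(2,6) by auto
    finally show ?thesis ..
  qed
  have I_le: "I \<subseteq> {..N}"
    using b_less[of _ "Suc r"] b_r unfolding I_def
    by (force simp: le_less_Suc_eq order_le_less)

  have V: "verts (wheel_graph N) = V"
  proof -
    have "w ` {..<N} = Rim ` {1..N}"
      unfolding w_def u_range[symmetric] by (simp add: image_image)
    then show ?thesis
      by (simp add: wheel_graph_def V_def)
  qed
  have es: "map (wheel_edge_pair N) es = steps 0"
    by (simp add: es_def steps_def map_concat w_def u_Suc comp_def)
  have "num_rooted_spanning_forests (wheel_graph N) R =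
      count (\<lambda>x. if x \<in> R then w 0 else x) (map (wheel_edge_pair N) es)"
    unfolding V[symmetric]
  proof (rule num_rooted_spanning_forests_eq_tree_count)
    show "distinct es"
      unfolding es_def using inj_u by (rule distinct_alternating)
    have "set es = Spoke ` u ` {..<N} \<union> Rim_Edge ` u ` {..<N}"
      by (auto simp: es_def)
    then show "set es = edges (wheel_graph N)"
      unfolding u_range by (auto simp: wheel_graph_def)
    show "\<forall>e\<in>edges (wheel_graph N). ends (wheel_graph N) e \<subseteq> verts (wheel_graph N)"
      using assms(1) by (auto simp: wheel_graph_def split: if_splits)
    show "w 0 \<in> R"
      using R zero_in_I by blast
    show "R \<subseteq> verts (wheel_graph N)"
      using assms(5,6) by (auto simp: wheel_graph_def)
  qed (simp add: ends_wheel_graph)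
  also have "\<dots> = count (\<lambda>x. if x \<in> w ` I then w 0 else x) (steps (b 1))"
    by (simp only: es R b_1)
  also have "\<dots> = (\<Sum>l = 1..r. (\<Sum>k<b (Suc l) - b l. fib (2 * k) + fib (2 * k + 2)) *
      (\<Prod>j \<in> {1..r} - {l}. fib (2 * (b (Suc j) - b j))))"
  \<comment> \<open>Initially the center is not joined to the roots, so the summation branch
    applies.\<close>
  proof (subst count_from_root[OF mono_b I_def b_r])
    show "admissible (\<lambda>x. if x \<in> w ` I then w 0 else x) (b 1)"
      unfolding b_1 using I_le zero_in_I by (rule admissible_initial)
  qed (use assms(1) zero_in_I w_neq_c[symmetric] in auto)
  also have "\<dots> = (\<Sum>i = 1..r. num_imperfect_matchings (cycle_graph (2 * d i)) *
      (\<Prod>j \<in> {1..r} - {i}. num_matchings (path_graph (2 * d j - 1))))"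
  proof (intro sum.cong prod.cong refl arg_cong2[of _ _ _ _ times])
    show "(\<Sum>k<b (Suc i) - b i. fib (2 * k) + fib (2 * k + 2)) =
        num_imperfect_matchings (cycle_graph (2 * d i))" if "i \<in> {1..r}" for i
      using sum_fib_eq_num_imperfect_matchings[OF d_pos] b_diff that by simp
    show "fib (2 * (b (Suc j) - b j)) = num_matchings (path_graph (2 * d j - 1))"
      if "j \<in> {1..r} - {i}" for i j
      using b_diff[of j] d_pos[of j] that by (simp add: num_matchings_path_graph)
  qed
  finally show ?thesis .
qed

end
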